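(* Let $f:\mathbb{R}^N\to\mathbb{R}$ be continuously differentiable and bounded below by a constant $f_{\rm low}$, and let its gradient be block Lipschitz continuous with respect to the partition $\{1,\dots,N\}=\bigcup_{\ell=1}^d b_\ell$ with block constants $L_\ell\ge0$. Let the bAdag algorithm with parameter $\varsigma\in(0,1)$ and starting point $x_0$ be applied to $\min_{x\in\mathbb{R}^N}f(x)$. Put $\Gamma_0=f(x_0)-f_{\rm low}$, $\bar L=\max_{\ell=1,\dots,d}L_\ell$ and $$\Theta=2\Gamma_0+2\sqrt{\varsigma}+2N\bar L\left[\log\left(\frac{2N\bar L}{\sqrt{\varsigma}}\right)-1\right].$$ Then: (GS) with the Gauss-Southwell rule, for all $k\ge0$, $$\frac1{k+1}\sum_{j=0}^k\|g_j\|\le\sqrt d\,\frac{\Theta}{\sqrt{k+1}};$$ (C) with the cyclic rule, if in addition the gradient is globally Lipschitz continuous with constant $L\ge0$, i.e. $\|g(x)-g(y)\|\le L\|x-y\|$ for all $x,y\in\mathbb{R}^N$, then for all $T\ge0$, $$\frac1{T+1}\sum_{t=0}^T\|g_{td}\|\le\sqrt{2\left(1+d\frac{L^2}{\varsigma^2}\right)}\,\frac{\Theta}{\sqrt{T+1}};$$ (UR) with uniformly random block selection, for all $k\ge0$, $$\mathbb{E}\left[\frac1{k+1}\sum_{j=0}^k\|g_j\|\right]\le d\,\frac{\Theta}{\sqrt{k+1}}.$$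
   Context: Notation. $\{1,\dots,N\}=\bigcup_{\ell=1}^d b_\ell$ is a fixed partition into $d$ (nonempty, pairwise disjoint) blocks. $g=\nabla f$, $g_k=g(x_k)$, and $g_{i,k}$ is its $i$-th component. For a vector $u\in\mathbb{R}^N$, $u^{(\ell)}$ is the vector equal to $u$ on the components in $b_\ell$ and zero elsewhere. $\|\cdot\|$ is the Euclidean norm; $\log$ is the natural logarithm, with the convention $0\log 0=0$. Block Lipschitz continuity: for every $\ell=1,\dots,d$, $\|g^{(\ell)}(x)-g^{(\ell)}(x+s^{(\ell)})\|\le L_\ell\|s^{(\ell)}\|$ for all $x\in\mathbb{R}^N$ and all $s^{(\ell)}\in\mathbb{R}^N$ with support contained in $b_\ell$. bAdag algorithm. Given $x_0\in\mathbb{R}^N$, $\varsigma\in(0,1)$, and $w_{i,-1}=\sqrt{\varsigma}$ for $i=1,\dots,N$. For $k=0,1,2,\dots$: select a block $b_{\ell_k}$; set $w_{i,k}=\sqrt{w_{i,k-1}^2+g_{i,k}^2}$ for $i\in b_{\ell_k}$ and $w_{i,k}=w_{i,k-1}$ otherwise; set $s_{i,k}=-g_{i,k}/w_{i,k}$ for $i\in b_{\ell_k}$ and $s_{i,k}=0$ otherwise; set $x_{k+1}=x_k+s_k$. Block selection rules. GS (Gauss-Southwell): $\ell_k$ is such that $\|g_k^{(\ell_k)}\|=\max_{\ell=1,\dots,d}\|g_k^{(\ell)}\|$. C (cyclic): blocks are picked in cyclic order, so every $d$ iterations each block is updated exactly once, i.e. $\ell_k=(k\bmod d)+1$; $t$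 and $T$ count full cycles of $d$ iterations. UR: $\ell_k$ is drawn uniformly from $\{1,\dots,d\}$, independently of the past; $\mathbb{E}$ is the expectation over all block choices ($x_0$ is deterministic). *)

theory Defs
  imports "HOL-Probability.Probability"
begin

text \<open>
  The space \<open>\<real>\<^sup>N\<close> is \<open>real ^ 'n\<close> with \<open>N = CARD('n)\<close>; the coordinate set \<open>{1,\<dots>,N}\<close> is the index
  type \<open>'n\<close>. Blocks are \<open>b 1, \<dots>, b d\<close>, so \<open>b :: nat \<Rightarrow> 'n set\<close> only matters on \<open>{1..d}\<close>.
\<close>

definition block_partition :: "nat \<Rightarrow> (nat \<Rightarrow> 'n::finite set) \<Rightarrow> bool" where
  "block_partition d b \<longleftrightarrow>
     (\<Union>l\<in>{1..d}. b l) = UNIV \<and> disjoint_family_on b {1..d} \<and> (\<forall>l\<in>{1..d}. b l \<noteq> {})"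

definition restr :: "'n::finite set \<Rightarrow> real ^ 'n \<Rightarrow> real ^ 'n" where
  "restr B u = (\<chi> i. if i \<in> B then u $ i else 0)"

definition block_lipschitz ::
  "nat \<Rightarrow> (nat \<Rightarrow> 'n::finite set) \<Rightarrow> (nat \<Rightarrow> real) \<Rightarrow> (real ^ 'n \<Rightarrow> real ^ 'n) \<Rightarrow> bool" where
  "block_lipschitz d b Lb g \<longleftrightarrow>
     (\<forall>l\<in>{1..d}. \<forall>x s. (\<forall>i. i \<notin> b l \<longrightarrow> s $ i = 0) \<longrightarrow>
        norm (restr (b l) (g x) - restr (b l) (g (x + s))) \<le> Lb l * norm s)"

definition badag_weight :: "'n::finite set \<Rightarrow> real ^ 'n \<Rightarrow> real ^ 'n \<Rightarrow> real ^ 'n" where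
  "badag_weight B gx w = (\<chi> i. if i \<in> B then sqrt ((w $ i)\<^sup>2 + (gx $ i)\<^sup>2) else w $ i)"

definition badag_step :: "'n::finite set \<Rightarrow> real ^ 'n \<Rightarrow> real ^ 'n \<Rightarrow> real ^ 'n" where
  "badag_step B gx w = (\<chi> i. if i \<in> B then - (gx $ i) / w $ i else 0)"

text \<open>
  The state before iteration \<open>k\<close>, for the block choices \<open>\<ell>\<^sub>0, \<ell>\<^sub>1, \<dots>\<close> given by \<open>ell\<close>, is the pair
  of \<open>x\<^sub>k\<close> and the weights \<open>w\<close> with index \<open>k - 1\<close>; the step is taken with the updated weights.
\<close>

primrec badag_state ::
  "(real ^ 'n \<Rightarrow> real ^ 'n) \<Rightarrow> real \<Rightarrow> real ^ 'n \<Rightarrow> (nat \<Rightarrow> 'n::finite set) \<Rightarrow> (nat \<Rightarrow> nat) \<Rightarrow> nat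
     \<Rightarrow> (real ^ 'n) \<times> (real ^ 'n)" where
  "badag_state g \<sigma> x0 b ell 0 = (x0, (\<chi> i. sqrt \<sigma>))"
| "badag_state g \<sigma> x0 b ell (Suc k) =
     (let (x, w) = badag_state g \<sigma> x0 b ell k;
          w' = badag_weight (b (ell k)) (g x) w
      in (x + badag_step (b (ell k)) (g x) w', w'))"

definition badag_iter ::
  "(real ^ 'n \<Rightarrow> real ^ 'n) \<Rightarrow> real \<Rightarrow> real ^ 'n \<Rightarrow> (nat \<Rightarrow> 'n::finite set) \<Rightarrow> (nat \<Rightarrow> nat) \<Rightarrow> nat
     \<Rightarrow> real ^ 'n" where
  "badag_iter g \<sigma> x0 b ell k = fst (badag_state g \<sigma> x0 b ell k)"

definition gauss_southwell ::
  "(real ^ 'n \<Rightarrow> real ^ 'n) \<Rightarrow> real \<Rightarrow> real ^ 'n \<Rightarrow> nat \<Rightarrow> (nat \<Rightarrow> 'n::finite set) \<Rightarrow> (nat \<Rightarrow> nat)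
     \<Rightarrow> bool" where
  "gauss_southwell g \<sigma> x0 d b ell \<longleftrightarrow>
     (\<forall>k. ell k \<in> {1..d} \<and>
        norm (restr (b (ell k)) (g (badag_iter g \<sigma> x0 b ell k))) =
          Max ((\<lambda>l. norm (restr (b l) (g (badag_iter g \<sigma> x0 b ell k)))) ` {1..d}))"

definition cyclic_rule :: "nat \<Rightarrow> nat \<Rightarrow> nat" where
  "cyclic_rule d k = k mod d + 1"

text \<open>
  Since \<open>x\<^sub>0\<close> is deterministic, the past of iteration \<open>k\<close> is determined by the choices made at
  the iterations before \<open>k\<close>, so independence of the past is mutual independence of the choices.
\<close>

definition uniform_random_rule :: "'a measure \<Rightarrow> nat \<Rightarrow> (nat \<Rightarrow> 'a \<Rightarrow> nat) \<Rightarrow> bool" where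
  "uniform_random_rule M d ell \<longleftrightarrow>
     prob_space M \<and>
     prob_space.indep_vars M (\<lambda>_. count_space {1..d}) ell UNIV \<and>
     (\<forall>k. distr M (count_space {1..d}) (ell k) = uniform_count_measure {1..d})"

text \<open>
  For \<open>Lbar = 0\<close> the last summand is \<open>0\<close>, in accordance with the convention \<open>0 log 0 = 0\<close>.
\<close>

definition badag_Theta :: "real \<Rightarrow> real \<Rightarrow> nat \<Rightarrow> real \<Rightarrow> real" where
  "badag_Theta \<Gamma>0 \<sigma> N Lbar =
     2 * \<Gamma>0 + 2 * sqrt \<sigma> + 2 * real N * Lbar * (ln (2 * real N * Lbar / sqrt \<sigma>) - 1)"

end

theory Submission
  imports Defs
begin

text \<open>
  Let \<open>W\<^sub>k = sqrt (\<sigma> + \<Sum>j<k. \<parallel>g\<^sub>j\<^sup>(\<^sup>\<ell>\<^sub>j\<^sup>)\<parallel>\<^sup>2)\<close> be the scalar weight that dominates all coordinate weights. The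
  block descent lemma, together with the telescoping bounds \<open>a\<^sup>2 / v \<ge> v - u\<close> and
  \<open>a\<^sup>2 / v\<^sup>2 \<le> 2 (ln v - ln u)\<close> for \<open>v\<^sup>2 = u\<^sup>2 + a\<^sup>2\<close>, gives
  \<open>W\<^sub>k - sqrt \<sigma> \<le> \<Gamma>\<^sub>0 + N Lbar ln (W\<^sub>k / sqrt \<sigma>)\<close>. Bounding the logarithm by its tangent at
  \<open>2 N Lbar\<close> yields \<open>W\<^sub>k \<le> \<Theta>\<close>, so the squared norms of the selected block gradients sum to at most
  \<open>\<Theta>\<^sup>2\<close>. Each selection rule compares the full gradient with the selected blocks.
\<close>

section \<open>Scalar inequalities for weights and averages\<close>

text \<open>As \<open>u \<le> v\<close>, the product \<open>(v - u) * v\<close> is at most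
  \<open>v\<^sup>2 - u\<^sup>2\<close>. This makes the first-order decrease telescope.\<close>

lemma adagrad_increment_le:
  fixes u v a :: real
  assumes "0 < u" "0 < v" "v\<^sup>2 = u\<^sup>2 + a\<^sup>2"
  shows "v - u \<le> a\<^sup>2 / v"
proof -
  have "u\<^sup>2 \<le> v\<^sup>2"
    using assms(3) by simp
  then have "u \<le> v"
    using assms(2) by (meson less_imp_le power2_le_imp_le)
  then have "u * u \<le> u * v"
    using assms(1) by (intro mult_left_mono) auto
  then have "(v - u) * v \<le> a\<^sup>2"
    using assms(3) by (simp add: power2_eq_square algebra_simps)
  then show ?thesis
    using assms(2) by (simp add: pos_le_divide_eq)
qed

text \<open>With \<open>r = u\<^sup>2 / v\<^sup>2\<close> the left side is \<open>1 - r\<close>, and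
  \<open>1 - r \<le> - ln r\<close>. Squared steps thus telescope in the logarithms of the
  weights.\<close>

lemma adagrad_ratio_le_ln_increment:
  fixes u v a :: real
  assumes "0 < u" "0 < v" "v\<^sup>2 = u\<^sup>2 + a\<^sup>2"
  shows "a\<^sup>2 / v\<^sup>2 \<le> 2 * (ln v - ln u)"
proof -
  have "a\<^sup>2 / v\<^sup>2 = 1 - u\<^sup>2 / v\<^sup>2"
    using assms by (simp add: field_simps)
  also have "\<dots> \<le> - ln (u\<^sup>2 / v\<^sup>2)"
    using ln_le_minus_one[of "u\<^sup>2 / v\<^sup>2"] assms(1,2) by simp
  also have "\<dots> = 2 * (ln v - ln u)"
    using assms(1,2) by (simp add: ln_div ln_realpow)
  finally show ?thesis .
qed

text \<open>The tangent of \<open>ln\<close> at \<open>2 * c\<close> has slope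
  \<open>1 / (2 * c)\<close>, so \<open>c * ln w\<close> costs only half of \<open>w\<close>;
  doubling what remains produces the factors 2.\<close>

lemma linear_minus_log_bound:
  fixes w s c \<Gamma> :: real
  assumes "0 < w" "0 < s" "0 \<le> c" "0 \<le> \<Gamma>"
    and "w - s \<le> \<Gamma> + c * (ln w - ln s)"
  shows "w \<le> 2 * \<Gamma> + 2 * s + 2 * c * (ln (2 * c / s) - 1)"
proof (cases "c = 0")
  \<comment> \<open>There is no tangent at 0, but the logarithmic terms carry the factor
    \<open>c = 0\<close> and vanish.\<close>
  case True
  then show ?thesis using assms by simp
next
  case False
  then have c: "0 < c" using assms by simp
  have "ln w - ln (2 * c) \<le> w / (2 * c) - 1"
    using ln_le_minus_one[of "w / (2 * c)"] c assms(1) by (simp add: ln_div)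
  then have "c * (ln w - ln (2 * c)) \<le> c * (w / (2 * c) - 1)"
    using c by (intro mult_left_mono) auto
  also have "\<dots> = w / 2 - c"
    using c by (simp add: field_simps)
  finally have "c * ln w \<le> c * ln (2 * c) + w / 2 - c"
    by (simp add: algebra_simps)
  moreover have ln_c: "ln (2 * c / s) = ln (2 * c) - ln s"
    using c assms(2) by (simp add: ln_div)
  ultimately show ?thesis
    using assms(5) unfolding ln_c by (simp add: algebra_simps)
qed

text \<open>Cauchy-Schwarz against the constant 1 on \<open>k + 1\<close> indices; the source of the
  square-root rate.\<close>

lemma average_le_of_sum_squares:
  fixes a :: "nat \<Rightarrow> real"
  assumes "(\<Sum>j\<le>k. (a j)\<^sup>2) \<le> C\<^sup>2" "0 \<le> C"
  shows "1 / (real k + 1) * (\<Sum>j\<le>k. a j) \<le> C / sqrt (real k + 1)"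
proof -
  have "(\<Sum>j\<le>k. a j)\<^sup>2 \<le> (\<Sum>j\<le>k. (a j)\<^sup>2) * real (card {..k})"
    by (rule sum_squared_le_sum_of_squares)
  also have "\<dots> \<le> C\<^sup>2 * (real k + 1)"
    using mult_right_mono[OF assms(1), of "real k + 1"] by (simp add: add.commute)
  also have "\<dots> = (C * sqrt (real k + 1))\<^sup>2"
    by (simp add: power_mult_distrib)
  finally have "(\<Sum>j\<le>k. a j) \<le> C * sqrt (real k + 1)"
    by (rule power2_le_imp_le) (use assms(2) in simp)
  then have "1 / (real k + 1) * (\<Sum>j\<le>k. a j) \<le> 1 / (real k + 1) * (C * sqrt (real k + 1))"
    by (intro mult_left_mono) auto
  also have "\<dots> = C / sqrt (real k + 1)"
    using real_sqrt_mult_self[of "real k + 1"] by (simp add: field_simps del: real_sqrt_mult_self)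
  finally show ?thesis .
qed

section \<open>Restriction to blocks and the Euclidean norm\<close>

lemma restr_nth [simp]: "restr B u $ i = (if i \<in> B then u $ i else 0)"
  by (simp add: restr_def)

lemma restr_diff: "restr B u - restr B v = restr B (u - v)"
  by (simp add: vec_eq_iff)

lemma norm_vec_squared: "(norm (u :: real ^ 'n))\<^sup>2 = (\<Sum>i\<in>UNIV. (u $ i)\<^sup>2)"
  by (simp only: power2_norm_eq_inner inner_vec_def) (simp add: power2_eq_square)

lemma norm_restr_squared: "(norm (restr B u))\<^sup>2 = (\<Sum>i\<in>B. (u $ i)\<^sup>2)"
proof -
  have "(norm (restr B u))\<^sup>2 = (\<Sum>i\<in>UNIV. if i \<in> B then (u $ i)\<^sup>2 else 0)"
    unfolding norm_vec_squared by (rule sum.cong) auto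
  then show ?thesis by (simp add: sum.If_cases)
qed

lemma norm_restr_le: "norm (restr B u) \<le> norm u"
proof (rule power2_le_imp_le)
  show "(norm (restr B u))\<^sup>2 \<le> (norm u)\<^sup>2"
    unfolding norm_vec_squared by (intro sum_mono) simp
qed simp

text \<open>Terms off \<open>B\<close> vanish, so a block step meets only the block part of the
  gradient, where Lipschitz continuity is available.\<close>

lemma inner_supported_eq_restr:
  assumes "\<And>i. i \<notin> B \<Longrightarrow> s $ i = 0"
  shows "u \<bullet> s = restr B u \<bullet> s"
  unfolding inner_vec_def by (rule sum.cong) (use assms in auto)

lemma norm_squared_block_partition:
  assumes "block_partition d b"
  shows "(norm u)\<^sup>2 = (\<Sum>l\<in>{1..d}. (norm (restr (b l) u))\<^sup>2)"
proof -
  have "(norm u)\<^sup>2 = (\<Sum>i\<in>(\<Union>l\<in>{1..d}. b l). (u $ i)\<^sup>2)"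
    using assms by (simp add: norm_vec_squared block_partition_def)
  also have "\<dots> = (\<Sum>l\<in>{1..d}. \<Sum>i\<in>b l. (u $ i)\<^sup>2)"
    using assms
    by (intro sum.UNION_disjoint) (auto simp: block_partition_def disjoint_family_on_def)
  finally show ?thesis by (simp add: norm_restr_squared)
qed

text \<open>By Pythagoras the norm is the l2 norm of the vector of block norms, which its l1 norm
  dominates. The linear form suits expectations.\<close>

lemma norm_le_sum_norm_blocks:
  assumes "block_partition d b"
  shows "norm u \<le> (\<Sum>l\<in>{1..d}. norm (restr (b l) u))"
proof -
  have "norm u = L2_set (\<lambda>l. norm (restr (b l) u)) {1..d}"
    unfolding L2_set_def norm_squared_block_partition[OF assms, symmetric] by simp
  also have "\<dots> \<le> (\<Sum>l\<in>{1..d}. norm (restr (b l) u))"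
    by (rule L2_set_le_sum) simp
  finally show ?thesis .
qed

text \<open>An empty family of blocks cannot cover the nonempty set of coordinates.\<close>

lemma block_partition_pos:
  assumes "block_partition d b"
  shows "1 \<le> d"
proof (rule ccontr)
  assume "\<not> 1 \<le> d"
  then show False using assms by (auto simp: block_partition_def)
qed

text \<open>Adaptedness: this is what makes iterate \<open>k\<close> independent of the random
  choice \<open>k\<close>.\<close>

lemma badag_state_cong:
  assumes "\<And>i. i < k \<Longrightarrow> ell i = ell' i"
  shows "badag_state g \<sigma> x0 b ell k = badag_state g \<sigma> x0 b ell' k"
  using assms by (induction k) auto

section \<open>Descent along a block\<close>

lemma block_descent:
  fixes f :: "real ^ 'n::finite \<Rightarrow> real"
  assumes gradient: "\<And>x. GDERIV f x :> g x"
    and lip: "\<And>x s. (\<And>i. i \<notin> B \<Longrightarrow> s $ i = 0) \<Longrightarrow>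
                norm (restr B (g x) - restr B (g (x + s))) \<le> L * norm s"
    and supp: "\<And>i. i \<notin> B \<Longrightarrow> s $ i = 0"
  shows "f (x + s) \<le> f x + g x \<bullet> s + L / 2 * (norm s)\<^sup>2"
proof -
  \<comment> \<open>Up to a constant, \<open>\<phi>\<close> is \<open>f\<close> on the segment minus
    its quadratic upper model; the claim is \<open>\<phi> 1 \<le> \<phi> 0\<close>.\<close>
  define \<phi> where "\<phi> t = f (x + t *\<^sub>R s) - t * (g x \<bullet> s) - L / 2 * t\<^sup>2 * (norm s)\<^sup>2" for t
  have f_line: "((\<lambda>t. f (x + t *\<^sub>R s)) has_real_derivative g (x + t *\<^sub>R s) \<bullet> s) (at t)" for t
  proof -
    have "((\<lambda>t. x + t *\<^sub>R s) has_derivative (\<lambda>h. h *\<^sub>R s)) (at t)"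
      by (auto intro!: derivative_eq_intros)
    from has_derivative_compose[OF this gradient[unfolded gderiv_def]]
    show ?thesis
      by (rule has_derivative_imp_has_field_derivative) (simp add: inner_commute)
  qed
  have "\<phi> 1 \<le> \<phi> 0"
  proof (rule DERIV_nonpos_imp_nonincreasing[where f = \<phi>])
    fix t :: real
    assume t: "0 \<le> t" "t \<le> 1"
    have "(\<phi> has_real_derivative
            g (x + t *\<^sub>R s) \<bullet> s - g x \<bullet> s - L * t * (norm s)\<^sup>2) (at t)"
      unfolding \<phi>_def by (auto intro!: derivative_eq_intros f_line)
    moreover have "g (x + t *\<^sub>R s) \<bullet> s - g x \<bullet> s - L * t * (norm s)\<^sup>2 \<le> 0"
    proof -
      have "g (x + t *\<^sub>R s) \<bullet> s - g x \<bullet> s = (restr B (g (x + t *\<^sub>R s)) - restr B (g x)) \<bullet> s"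
        using inner_supported_eq_restr[of B s "g (x + t *\<^sub>R s) - g x"] supp
        by (simp add: restr_diff inner_diff_left)
      also have "\<dots> \<le> norm (restr B (g (x + t *\<^sub>R s)) - restr B (g x)) * norm s"
        by (rule norm_cauchy_schwarz)
      also have "\<dots> \<le> (L * norm (t *\<^sub>R s)) * norm s"
        using lip[of "t *\<^sub>R s" x] supp by (intro mult_right_mono) (auto simp: norm_minus_commute)
      also have "\<dots> = L * t * (norm s)\<^sup>2"
        using t by (simp add: power2_eq_square)
      finally show ?thesis by simp
    qed
    ultimately show "\<exists>y. (\<phi> has_real_derivative y) (at t) \<and> y \<le> 0" by blast
  qed simp
  then show ?thesis by (simp add: \<phi>_def)
qed

section \<open>Analysis of a run with arbitrary block choices\<close>

text \<open>The choices \<open>ell\<close> are any fixed sequence, so the results serve both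
  deterministic rules and each single outcome of the random one.\<close>

locale badag_run =
  fixes f :: "real ^ 'n::finite \<Rightarrow> real"
    and g :: "real ^ 'n \<Rightarrow> real ^ 'n"
    and f_low \<sigma> Lbar :: real
    and x0 :: "real ^ 'n"
    and d :: nat
    and b :: "nat \<Rightarrow> 'n set"
    and Lb :: "nat \<Rightarrow> real"
    and ell :: "nat \<Rightarrow> nat"
  assumes gradient: "GDERIV f x :> g x"
    and bounded_below: "f_low \<le> f x"
    and partition: "block_partition d b"
    and Lb_nonneg: "l \<in> {1..d} \<Longrightarrow> 0 \<le> Lb l"
    and block_lipschitz: "block_lipschitz d b Lb g"
    and \<sigma>: "0 < \<sigma>" "\<sigma> < 1"
    and Lbar: "Lbar = Max (Lb ` {1..d})"
    and ell: "ell k \<in> {1..d}"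
begin

definition x :: "nat \<Rightarrow> real ^ 'n" where
  "x k = badag_iter g \<sigma> x0 b ell k"

text \<open>\<open>w k\<close> holds the weights with index \<open>k - 1\<close> of the algorithm.\<close>

definition w :: "nat \<Rightarrow> real ^ 'n" where
  "w k = snd (badag_state g \<sigma> x0 b ell k)"

definition gb :: "nat \<Rightarrow> real ^ 'n" where
  "gb k = restr (b (ell k)) (g (x k))"

text \<open>Using \<open>gb\<close> avoids a case split: off the selected block the numerator is 0.
  The index \<open>Suc k\<close> picks the updated weights.\<close>

definition s :: "nat \<Rightarrow> real ^ 'n" where
  "s k = (\<chi> i. - (gb k $ i) / w (Suc k) $ i)"

text \<open>An auxiliary scalar weight that accumulates whole block gradients; the algorithm itself
  never computes it.\<close>

definition W :: "nat \<Rightarrow> real" where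
  "W k = sqrt (\<sigma> + (\<Sum>j<k. (norm (gb j))\<^sup>2))"

abbreviation \<Theta> :: real where
  "\<Theta> \<equiv> badag_Theta (f x0 - f_low) \<sigma> CARD('n) Lbar"

lemma w_Suc: "w (Suc k) = badag_weight (b (ell k)) (g (x k)) (w k)"
  by (simp add: w_def x_def badag_iter_def Let_def case_prod_beta)

lemma w_0: "w 0 $ i = sqrt \<sigma>"
  by (simp add: w_def)

lemma x_0: "x 0 = x0"
  by (simp add: x_def badag_iter_def)

lemma x_Suc: "x (Suc k) = x k + s k"
proof -
  have "x (Suc k) = x k + badag_step (b (ell k)) (g (x k)) (w (Suc k))"
    unfolding w_Suc by (simp add: x_def w_def badag_iter_def Let_def case_prod_beta)
  also have "badag_step (b (ell k)) (g (x k)) (w (Suc k)) = s k"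
    by (simp add: vec_eq_iff badag_step_def s_def gb_def)
  finally show ?thesis .
qed

text \<open>Since \<open>gb\<close> vanishes off the selected block, updated and frozen coordinates
  obey one recursion.\<close>

lemma w_squared: "(w k $ i)\<^sup>2 = \<sigma> + (\<Sum>j<k. (gb j $ i)\<^sup>2)"
proof (induction k)
  case 0
  then show ?case using \<sigma> by (simp add: w_def)
next
  case (Suc k)
  have "(w (Suc k) $ i)\<^sup>2 = (w k $ i)\<^sup>2 + (gb k $ i)\<^sup>2"
    by (simp add: w_Suc badag_weight_def gb_def)
  then show ?case using Suc by simp
qed

lemma w_nonneg: "0 \<le> w k $ i"
proof (induction k)
  case 0
  then show ?case using \<sigma> by (simp add: w_def)
next
  case (Suc k)
  then show ?case by (simp add: w_Suc badag_weight_def)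
qed

lemma \<sigma>_le_w_squared: "\<sigma> \<le> (w k $ i)\<^sup>2"
  unfolding w_squared by (simp add: sum_nonneg)

lemma w_pos: "0 < w k $ i"
  using \<sigma>_le_w_squared[of k i] w_nonneg[of k i] \<sigma> by (cases "w k $ i = 0") auto

lemma W_pos: "0 < W k"
  unfolding W_def using \<sigma> by (simp add: add_pos_nonneg sum_nonneg)

lemma W_squared: "(W k)\<^sup>2 = \<sigma> + (\<Sum>j<k. (norm (gb j))\<^sup>2)"
  unfolding W_def using \<sigma> by (simp add: add_nonneg_nonneg sum_nonneg)

lemma w_le_W: "w k $ i \<le> W k"
proof (rule power2_le_imp_le)
  have "(gb j $ i)\<^sup>2 \<le> (norm (gb j))\<^sup>2" for j
    using power_mono[OF component_le_norm_cart[of "gb j" i], of 2] by simp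
  then show "(w k $ i)\<^sup>2 \<le> (W k)\<^sup>2"
    unfolding w_squared W_squared by (intro add_left_mono sum_mono)
qed (use W_pos[of k] in simp)

lemma Lb_le_Lbar: "l \<in> {1..d} \<Longrightarrow> Lb l \<le> Lbar"
  unfolding Lbar by (intro Max_ge) auto

lemma Lbar_nonneg: "0 \<le> Lbar"
  using Lb_nonneg[OF ell] Lb_le_Lbar[OF ell] by (rule order_trans)

lemma s_supp: "i \<notin> b (ell k) \<Longrightarrow> s k $ i = 0"
  by (simp add: s_def gb_def)

lemma norm_s_squared: "(norm (s k))\<^sup>2 = (\<Sum>i\<in>UNIV. (gb k $ i)\<^sup>2 / (w (Suc k) $ i)\<^sup>2)"
  by (simp add: norm_vec_squared s_def power_divide)

text \<open>Every squared weight is at least \<open>\<sigma>\<close>.\<close>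

lemma norm_s_squared_le: "(norm (s k))\<^sup>2 \<le> (norm (gb k))\<^sup>2 / \<sigma>"
proof -
  have "(norm (s k))\<^sup>2 \<le> (\<Sum>i\<in>UNIV. (gb k $ i)\<^sup>2 / \<sigma>)"
    unfolding norm_s_squared using \<sigma>_le_w_squared \<sigma> w_pos
    by (intro sum_mono divide_left_mono mult_pos_pos zero_less_power) auto
  then show ?thesis
    by (simp add: norm_vec_squared sum_divide_distrib)
qed

text \<open>In the block descent inequality the linear term pays for the growth of \<open>W\<close>,
  and the quadratic term is charged to the logarithmic growth of the coordinate weights.\<close>

lemma one_step_descent:
  "f (x (Suc k)) \<le> f (x k) - (W (Suc k) - W k) +
     Lbar * (\<Sum>i\<in>UNIV. ln (w (Suc k) $ i) - ln (w k $ i))"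
proof -
  have step: "f (x (Suc k)) \<le> f (x k) + g (x k) \<bullet> s k + Lb (ell k) / 2 * (norm (s k))\<^sup>2"
    unfolding x_Suc
  proof (rule block_descent[OF gradient _ s_supp])
    fix y v :: "real ^ 'n"
    assume "\<And>i. i \<notin> b (ell k) \<Longrightarrow> v $ i = 0"
    then show "norm (restr (b (ell k)) (g y) - restr (b (ell k)) (g (y + v)))
                 \<le> Lb (ell k) * norm v"
      using block_lipschitz ell[of k] unfolding block_lipschitz_def by blast
  qed
  have first_order: "g (x k) \<bullet> s k \<le> - (W (Suc k) - W k)"
  proof -
    have "W (Suc k) - W k \<le> (norm (gb k))\<^sup>2 / W (Suc k)"
      using W_pos by (intro adagrad_increment_le) (auto simp: W_squared)
    also have "\<dots> = (\<Sum>i\<in>UNIV. (gb k $ i)\<^sup>2 / W (Suc k))"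
      by (simp add: norm_vec_squared sum_divide_distrib)
    \<comment> \<open>Each coordinate weight is below \<open>W (Suc k)\<close>, so the actual step
      decreases at least as much as one scaled by \<open>W\<close>.\<close>
    also have "\<dots> \<le> (\<Sum>i\<in>UNIV. (gb k $ i)\<^sup>2 / w (Suc k) $ i)"
      using w_le_W w_pos W_pos by (intro sum_mono divide_left_mono) auto
    also have "\<dots> = - (gb k \<bullet> s k)"
      by (simp add: inner_vec_def s_def sum_negf power2_eq_square)
    also have "gb k \<bullet> s k = g (x k) \<bullet> s k"
      unfolding gb_def using inner_supported_eq_restr[of "b (ell k)" "s k"] s_supp by simp
    finally show ?thesis by simp
  qed
  have second_order: "Lb (ell k) / 2 * (norm (s k))\<^sup>2 \<le>
      Lbar * (\<Sum>i\<in>UNIV. ln (w (Suc k) $ i) - ln (w k $ i))"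
  proof -
    \<comment> \<open>The factor 2 cancels the 1/2 of the quadratic term.\<close>
    have "(norm (s k))\<^sup>2 \<le> (\<Sum>i\<in>UNIV. 2 * (ln (w (Suc k) $ i) - ln (w k $ i)))"
      unfolding norm_s_squared
      by (intro sum_mono adagrad_ratio_le_ln_increment w_pos) (simp add: w_squared)
    then have "(norm (s k))\<^sup>2 / 2 \<le> (\<Sum>i\<in>UNIV. ln (w (Suc k) $ i) - ln (w k $ i))"
      unfolding sum_distrib_left[symmetric] by simp
    then have "Lb (ell k) * ((norm (s k))\<^sup>2 / 2) \<le>
        Lbar * (\<Sum>i\<in>UNIV. ln (w (Suc k) $ i) - ln (w k $ i))"
      using Lb_le_Lbar[OF ell] Lbar_nonneg by (intro mult_mono) auto
    then show ?thesis by simp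
  qed
  show ?thesis
    using order_trans[OF step add_mono[OF add_left_mono[OF first_order] second_order]] by simp
qed

text \<open>The one-step bounds telescope; both \<open>W\<close> and all coordinate weights start at
  \<open>sqrt \<sigma>\<close>.\<close>

lemma descent:
  "f (x k) \<le> f x0 - (W k - sqrt \<sigma>) + Lbar * (\<Sum>i\<in>UNIV. ln (w k $ i) - ln (sqrt \<sigma>))"
proof -
  define P where "P k = Lbar * (\<Sum>i\<in>UNIV. ln (w k $ i) - ln (sqrt \<sigma>))" for k
  have P_Suc: "Lbar * (\<Sum>i\<in>UNIV. ln (w (Suc k) $ i) - ln (w k $ i)) = P (Suc k) - P k" for k
    unfolding P_def by (simp only: sum_subtractf right_diff_distrib)
  have "f (x k) \<le> f x0 - (W k - sqrt \<sigma>) + P k"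
  proof (induction k)
    case 0
    show ?case unfolding P_def x_0 w_0 by (simp add: W_def)
  next
    case (Suc k)
    then show ?case using one_step_descent[of k] unfolding P_Suc by linarith
  qed
  then show ?thesis unfolding P_def .
qed

text \<open>Replacing every coordinate weight by \<open>W k\<close> and \<open>f (x k)\<close> by
  \<open>f_low\<close> leaves a scalar inequality in \<open>W k\<close> alone, solved with
  \<open>c = N * Lbar\<close>.\<close>

lemma W_le_Theta: "W k \<le> \<Theta>"
proof -
  have "(\<Sum>i\<in>UNIV. ln (w k $ i) - ln (sqrt \<sigma>)) \<le> (\<Sum>i\<in>(UNIV :: 'n set). ln (W k) - ln (sqrt \<sigma>))"
    using w_le_W w_pos W_pos by (intro sum_mono diff_right_mono) simp
  then have "Lbar * (\<Sum>i\<in>UNIV. ln (w k $ i) - ln (sqrt \<sigma>)) \<le>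
      Lbar * (real CARD('n) * (ln (W k) - ln (sqrt \<sigma>)))"
    using Lbar_nonneg by (intro mult_left_mono) auto
  then have "W k - sqrt \<sigma> \<le> (f x0 - f_low) + real CARD('n) * Lbar * (ln (W k) - ln (sqrt \<sigma>))"
    using descent[of k] bounded_below[of "x k"] by (simp add: mult_ac)
  then have "W k \<le> 2 * (f x0 - f_low) + 2 * sqrt \<sigma> +
      2 * (real CARD('n) * Lbar) * (ln (2 * (real CARD('n) * Lbar) / sqrt \<sigma>) - 1)"
    using W_pos \<sigma> Lbar_nonneg bounded_below[of x0]
    by (intro linear_minus_log_bound) auto
  then show ?thesis by (simp add: badag_Theta_def mult.assoc)
qed

text \<open>Not evident from the formula, whose logarithmic term may be negative; it follows from
  the positive \<open>W 0\<close> lying below \<open>\<Theta>\<close>.\<close>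

lemma Theta_nonneg: "0 \<le> \<Theta>"
  using W_pos[of 0] W_le_Theta[of 0] by simp

lemma sum_block_gradients_squared_le: "(\<Sum>j<k. (norm (gb j))\<^sup>2) \<le> \<Theta>\<^sup>2"
proof -
  have "(W k)\<^sup>2 \<le> \<Theta>\<^sup>2"
    using W_le_Theta[of k] W_pos[of k] by (intro power_mono) auto
  then show ?thesis using \<sigma> by (simp add: W_squared)
qed

section \<open>Gauss-Southwell selection\<close>

text \<open>Each of the \<open>d\<close> block norms is at most the selected one, which costs a
  factor \<open>d\<close> on squares and \<open>sqrt d\<close> on norms.\<close>

lemma gauss_southwell_bound:
  assumes "gauss_southwell g \<sigma> x0 d b ell"
  shows "1 / (real k + 1) * (\<Sum>j\<le>k. norm (g (x j))) \<le> sqrt (real d) * (\<Theta> / sqrt (real k + 1))"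
proof -
  have block: "(norm (g (x j)))\<^sup>2 \<le> real d * (norm (gb j))\<^sup>2" for j
  proof -
    have max: "norm (restr (b l) (g (x j))) \<le> norm (gb j)" if "l \<in> {1..d}" for l
      using assms that unfolding gauss_southwell_def gb_def x_def by simp
    have "(norm (g (x j)))\<^sup>2 = (\<Sum>l\<in>{1..d}. (norm (restr (b l) (g (x j))))\<^sup>2)"
      by (rule norm_squared_block_partition[OF partition])
    also have "\<dots> \<le> (\<Sum>l\<in>{1..d}. (norm (gb j))\<^sup>2)"
      by (intro sum_mono power_mono max) auto
    finally show ?thesis by simp
  qed
  have "(\<Sum>j\<le>k. (norm (g (x j)))\<^sup>2) \<le> (\<Sum>j\<le>k. real d * (norm (gb j))\<^sup>2)"
    by (intro sum_mono block)
  also have "\<dots> \<le> real d * \<Theta>\<^sup>2"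
    unfolding sum_distrib_left[symmetric]
    using sum_block_gradients_squared_le[of "Suc k"]
    by (intro mult_left_mono) (simp_all only: lessThan_Suc_atMost of_nat_0_le_iff)
  also have "\<dots> = (sqrt (real d) * \<Theta>)\<^sup>2"
    by (simp add: power_mult_distrib)
  finally have "1 / (real k + 1) * (\<Sum>j\<le>k. norm (g (x j))) \<le> sqrt (real d) * \<Theta> / sqrt (real k + 1)"
    by (rule average_le_of_sum_squares) (simp add: Theta_nonneg)
  then show ?thesis by simp
qed

section \<open>Cyclic selection\<close>

text \<open>Steps within one cycle live on disjoint blocks, hence are orthogonal, and their squared
  norms add up without a factor \<open>d\<close>.\<close>

lemma cyclic_displacement:
  assumes cyclic: "ell = cyclic_rule d" and p: "p < d"
  shows "(norm (x (t * d + p) - x (t * d)))\<^sup>2 \<le> (\<Sum>q<d. (norm (gb (t * d + q)))\<^sup>2) / \<sigma>"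
proof -
  have "x (t * d + p) - x (t * d) = (\<Sum>q<p. s (t * d + q))"
    by (induction p) (simp_all add: x_Suc algebra_simps)
  also have "(norm \<dots>)\<^sup>2 = (\<Sum>q<p. (norm (s (t * d + q)))\<^sup>2)"
  proof (rule norm_sum_Pythagorean)
    show "pairwise (\<lambda>q r. orthogonal (s (t * d + q)) (s (t * d + r))) {..<p}"
    proof (rule pairwiseI)
      fix q r assume qr: "q \<in> {..<p}" "r \<in> {..<p}" "q \<noteq> r"
      then have "ell (t * d + q) = q + 1" "ell (t * d + r) = r + 1"
        using p by (simp_all add: cyclic cyclic_rule_def)
      then have "b (ell (t * d + q)) \<inter> b (ell (t * d + r)) = {}"
        using partition qr p unfolding block_partition_def disjoint_family_on_def by simp
      then have "s (t * d + q) $ i = 0 \<or> s (t * d + r) $ i = 0" for i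
        using s_supp by blast
      then show "orthogonal (s (t * d + q)) (s (t * d + r))"
        by (auto simp: orthogonal_def inner_vec_def intro!: sum.neutral)
    qed
  qed simp
  also have "\<dots> \<le> (\<Sum>q<p. (norm (gb (t * d + q)))\<^sup>2 / \<sigma>)"
    by (intro sum_mono norm_s_squared_le)
  also have "\<dots> \<le> (\<Sum>q<d. (norm (gb (t * d + q)))\<^sup>2 / \<sigma>)"
    using p \<sigma> by (intro sum_mono2) auto
  finally show ?thesis by (simp add: sum_divide_distrib)
qed

text \<open>Each block gradient at the start of a cycle is compared with its value when that block
  is updated; the drift is controlled by \<open>L\<close> times the displacement. Summing the drift
  over all blocks gives the factor \<open>d\<close>.\<close>

lemma cyclic_cycle_bound:
  assumes cyclic: "ell = cyclic_rule d"
    and L: "0 \<le> L" "\<And>y z. norm (g y - g z) \<le> L * norm (y - z)"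
  shows "(norm (g (x (t * d))))\<^sup>2 \<le>
           2 * (1 + real d * (L\<^sup>2 / \<sigma>\<^sup>2)) * (\<Sum>q<d. (norm (gb (t * d + q)))\<^sup>2)"
proof -
  define S where "S = (\<Sum>q<d. (norm (gb (t * d + q)))\<^sup>2)"
  have S: "0 \<le> S" unfolding S_def by (simp add: sum_nonneg)
  have block: "(norm (restr (b (Suc p)) (g (x (t * d)))))\<^sup>2 \<le>
      2 * (norm (gb (t * d + p)))\<^sup>2 + 2 * (L\<^sup>2 / \<sigma>\<^sup>2) * S" if p: "p < d" for p
  proof -
    let ?u = "restr (b (Suc p)) (g (x (t * d)) - g (x (t * d + p)))"
    have "ell (t * d + p) = Suc p"
      using p by (simp add: cyclic cyclic_rule_def)
    then have "restr (b (Suc p)) (g (x (t * d))) = gb (t * d + p) + ?u"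
      by (simp add: vec_eq_iff gb_def)
    then have "norm (restr (b (Suc p)) (g (x (t * d)))) \<le> norm (gb (t * d + p)) + norm ?u"
      by (simp add: norm_triangle_ineq)
    then have "(norm (restr (b (Suc p)) (g (x (t * d)))))\<^sup>2 \<le> (norm (gb (t * d + p)) + norm ?u)\<^sup>2"
      by (rule power_mono) simp
    \<comment> \<open>From \<open>(a - b)\<^sup>2 \<ge> 0\<close>; the origin of the factor
      2.\<close>
    also have "\<dots> \<le> 2 * (norm (gb (t * d + p)))\<^sup>2 + 2 * (norm ?u)\<^sup>2"
      using zero_le_power2[of "norm (gb (t * d + p)) - norm ?u"]
      by (simp add: power2_eq_square algebra_simps)
    also have "(norm ?u)\<^sup>2 \<le> L\<^sup>2 / \<sigma>\<^sup>2 * S"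
    proof -
      have "norm ?u \<le> L * norm (x (t * d) - x (t * d + p))"
        using norm_restr_le L(2) by (rule order_trans)
      then have "(norm ?u)\<^sup>2 \<le> (L * norm (x (t * d) - x (t * d + p)))\<^sup>2"
        by (rule power_mono) simp
      also have "\<dots> = L\<^sup>2 * (norm (x (t * d + p) - x (t * d)))\<^sup>2"
        by (simp add: power_mult_distrib norm_minus_commute)
      also have "\<dots> \<le> L\<^sup>2 * (S / \<sigma>)"
        using cyclic_displacement[OF cyclic p] unfolding S_def by (intro mult_left_mono) auto
      \<comment> \<open>As \<open>\<sigma> < 1\<close>, this passes to the power of
        \<open>\<sigma>\<close> in the stated constant.\<close>
      also have "S / \<sigma> \<le> S / \<sigma>\<^sup>2"
        using \<sigma> S by (intro divide_left_mono) (auto simp: power2_eq_square)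
      then have "L\<^sup>2 * (S / \<sigma>) \<le> L\<^sup>2 * (S / \<sigma>\<^sup>2)"
        by (intro mult_left_mono) auto
      finally show ?thesis by simp
    qed
    finally show ?thesis by simp
  qed
  have "(norm (g (x (t * d))))\<^sup>2 = (\<Sum>l\<in>{1..d}. (norm (restr (b l) (g (x (t * d)))))\<^sup>2)"
    by (rule norm_squared_block_partition[OF partition])
  also have "\<dots> = (\<Sum>p<d. (norm (restr (b (Suc p)) (g (x (t * d)))))\<^sup>2)"
    by (rule sum.reindex_bij_witness[of _ Suc "\<lambda>l. l - 1"]) auto
  also have "\<dots> \<le> (\<Sum>p<d. 2 * (norm (gb (t * d + p)))\<^sup>2 + 2 * (L\<^sup>2 / \<sigma>\<^sup>2) * S)"
    by (intro sum_mono block) auto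
  also have "\<dots> = 2 * S + real d * (2 * (L\<^sup>2 / \<sigma>\<^sup>2) * S)"
    by (simp add: sum.distrib sum_distrib_left[symmetric] S_def[symmetric])
  finally show ?thesis
    unfolding S_def[symmetric] by (simp add: algebra_simps)
qed

lemma cyclic_bound:
  assumes cyclic: "ell = cyclic_rule d"
    and L: "0 \<le> L" "\<And>y z. norm (g y - g z) \<le> L * norm (y - z)"
  shows "1 / (real T + 1) * (\<Sum>t\<le>T. norm (g (x (t * d))))
           \<le> sqrt (2 * (1 + real d * (L\<^sup>2 / \<sigma>\<^sup>2))) * (\<Theta> / sqrt (real T + 1))"
proof -
  define C where "C = 2 * (1 + real d * (L\<^sup>2 / \<sigma>\<^sup>2))"
  have C: "0 \<le> C" unfolding C_def by simp
  \<comment> \<open>The cycles up to \<open>n\<close> enumerate the iterations before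
    \<open>Suc n * d\<close> once each, so the bound on the whole run applies.\<close>
  have flat: "(\<Sum>t\<le>n. \<Sum>q<d. (norm (gb (t * d + q)))\<^sup>2) = (\<Sum>j<Suc n * d. (norm (gb j))\<^sup>2)" for n
  proof -
    have "(\<Sum>q<d. (norm (gb (t * d + q)))\<^sup>2) = (\<Sum>j\<in>{t * d..<t * d + d}. (norm (gb j))\<^sup>2)" for t
      by (rule sum.reindex_bij_witness[of _ "\<lambda>j. j - t * d" "\<lambda>q. t * d + q"]) auto
    then show ?thesis
      unfolding lessThan_Suc_atMost[symmetric] by (simp only: sum.nat_group)
  qed
  have "(\<Sum>t\<le>T. (norm (g (x (t * d))))\<^sup>2) \<le> (\<Sum>t\<le>T. C * (\<Sum>q<d. (norm (gb (t * d + q)))\<^sup>2))"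
    unfolding C_def by (intro sum_mono cyclic_cycle_bound[OF cyclic L])
  also have "\<dots> \<le> C * \<Theta>\<^sup>2"
    unfolding sum_distrib_left[symmetric] flat
    by (intro mult_left_mono sum_block_gradients_squared_le C)
  also have "\<dots> = (sqrt C * \<Theta>)\<^sup>2"
    using C by (simp add: power_mult_distrib)
  finally have "1 / (real T + 1) * (\<Sum>t\<le>T. norm (g (x (t * d)))) \<le> sqrt C * \<Theta> / sqrt (real T + 1)"
    by (rule average_le_of_sum_squares) (simp add: Theta_nonneg C)
  then show ?thesis unfolding C_def by simp
qed

text \<open>The pathwise estimate to be integrated under random selection.\<close>

lemma block_average_bound:
  "1 / (real k + 1) * (\<Sum>j\<le>k. norm (gb j)) \<le> \<Theta> / sqrt (real k + 1)"
  using sum_block_gradients_squared_le[of "Suc k"] Theta_nonneg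
  unfolding lessThan_Suc_atMost by (rule average_le_of_sum_squares)

end

section \<open>Uniformly random selection\<close>

text \<open>The first \<open>k\<close> choices take finitely many values, so any function of them is
  measurable and bounded, whatever \<open>h\<close> is.\<close>

lemma uniform_random_past_integrable:
  fixes h :: "(nat \<Rightarrow> nat) \<Rightarrow> real"
  assumes rule: "uniform_random_rule M d ell"
    and past: "\<And>e e'. (\<And>i. i < k \<Longrightarrow> e i = e' i) \<Longrightarrow> h e = h e'"
  shows "integrable M (\<lambda>\<omega>. h (\<lambda>i. ell i \<omega>))"
proof -
  interpret prob_space M using rule by (simp add: uniform_random_rule_def)
  have meas: "ell i \<in> M \<rightarrow>\<^sub>M count_space {1..d}" for i
    using rule unfolding uniform_random_rule_def indep_vars_def by simp
  define X where "X \<omega> = (\<lambda>i\<in>{..<k}. ell i \<omega>)" for \<omega>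
  have hX: "h (\<lambda>i. ell i \<omega>) = h (X \<omega>)" for \<omega>
    by (rule past) (simp add: X_def)
  have "X \<in> M \<rightarrow>\<^sub>M PiM {..<k} (\<lambda>_. count_space {1..d})"
    unfolding X_def by (intro measurable_restrict meas)
  \<comment> \<open>A finite product of finite discrete spaces is discrete.\<close>
  also have "PiM {..<k} (\<lambda>_. count_space {1..d}) = count_space ({..<k} \<rightarrow>\<^sub>E {1..d})"
    by (intro count_space_PiM_finite) auto
  finally have X: "X \<in> M \<rightarrow>\<^sub>M count_space ({..<k} \<rightarrow>\<^sub>E {1..d})" .
  define C where "C = Max ((\<lambda>e. \<bar>h e\<bar>) ` ({..<k} \<rightarrow>\<^sub>E {1..d}))"
  have "\<bar>h (X \<omega>)\<bar> \<le> C" if "\<omega> \<in> space M" for \<omega>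
    unfolding C_def using measurable_space[OF X that]
    by (intro Max_ge) (auto intro!: finite_imageI finite_PiE)
  then have "integrable M (\<lambda>\<omega>. h (X \<omega>))"
    by (intro integrable_const_bound[where B = C]) (auto intro!: measurable_compose[OF X])
  then show ?thesis by (simp add: hX)
qed

text \<open>The tower property without conditional expectations: split by the value \<open>l\<close>
  of choice \<open>k\<close>, factor each term by independence from the past, and use probability
  \<open>1 / d\<close>.\<close>

lemma uniform_random_conditional_average:
  fixes h :: "nat \<Rightarrow> (nat \<Rightarrow> nat) \<Rightarrow> real"
  assumes rule: "uniform_random_rule M d ell" and d: "1 \<le> d"
    and past: "\<And>l e e'. (\<And>i. i < k \<Longrightarrow> e i = e' i) \<Longrightarrow> h l e = h l e'"
  shows "(\<integral>\<omega>. h (ell k \<omega>) (\<lambda>i. ell i \<omega>) \<partial>M) =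
           (\<integral>\<omega>. (\<Sum>l\<in>{1..d}. h l (\<lambda>i. ell i \<omega>)) \<partial>M) / real d"
proof -
  interpret prob_space M using rule by (simp add: uniform_random_rule_def)
  let ?N = "count_space {1..d} :: nat measure"
  have indep: "indep_vars (\<lambda>_. ?N) ell UNIV"
    using rule by (simp add: uniform_random_rule_def)
  have meas: "ell i \<in> M \<rightarrow>\<^sub>M ?N" for i
    using indep unfolding indep_vars_def by simp
  have range: "ell i \<omega> \<in> {1..d}" if "\<omega> \<in> space M" for i \<omega>
    using measurable_space[OF meas that] by simp
  define X where "X \<omega> = (\<lambda>i\<in>{..<k}. ell i \<omega>)" for \<omega>
  define Y where "Y \<omega> = (\<lambda>i\<in>{k}. ell i \<omega>)" for \<omega>
  have PiM: "PiM {..<k} (\<lambda>_. ?N) = count_space ({..<k} \<rightarrow>\<^sub>E {1..d})"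
    by (intro count_space_PiM_finite) auto
  \<comment> \<open>Past and present use the disjoint index sets \<open>{..<k}\<close> and
    \<open>{k}\<close>; hence \<open>Y\<close> packs a single choice as a function on
    \<open>{k}\<close>.\<close>
  have XY: "indep_var (PiM {..<k} (\<lambda>_. ?N)) X (PiM {k} (\<lambda>_. ?N)) Y"
    unfolding X_def Y_def by (rule indep_var_restrict[OF indep]) auto
  have prob: "expectation (\<lambda>\<omega>. indicator {l} (ell k \<omega>)) = 1 / real d" if l: "l \<in> {1..d}" for l
  proof -
    have "expectation (\<lambda>\<omega>. indicator {l} (ell k \<omega>) :: real) =
        (\<integral>y. indicator {l} y \<partial>distr M ?N (ell k))"
      by (rule integral_distr[symmetric, OF meas]) simp
    also have "distr M ?N (ell k) = uniform_count_measure {1..d}"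
      using rule by (simp add: uniform_random_rule_def)
    also have "(\<integral>y. indicator {l} y \<partial>uniform_count_measure {1..d}) =
        measure (uniform_count_measure {1..d}) {l}"
      using l by simp
    also have "\<dots> = 1 / real d"
      using l by (subst measure_uniform_count_measure) auto
    finally show ?thesis .
  qed
  have int: "integrable M (\<lambda>\<omega>. h l (\<lambda>i. ell i \<omega>))" for l
    by (rule uniform_random_past_integrable[OF rule, of k]) (rule past)
  have ind_int: "integrable M (\<lambda>\<omega>. indicator {l} (ell k \<omega>) :: real)" for l
    by (rule integrable_const_bound[where B = 1])
      (auto intro!: measurable_compose[OF meas] simp: indicator_def)
  have hX: "h l (\<lambda>i. ell i \<omega>) = h l (X \<omega>)" for l \<omega>
    by (rule past) (simp add: X_def)
  have Yk: "Y \<omega> k = ell k \<omega>" for \<omega>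
    by (simp add: Y_def)
  have ind: "indep_var borel (\<lambda>\<omega>. h l (\<lambda>i. ell i \<omega>)) borel (\<lambda>\<omega>. indicator {l} (ell k \<omega>) :: real)"
    for l
  proof -
    have "indep_var borel (h l \<circ> X) borel ((\<lambda>y. indicator {l} (y k) :: real) \<circ> Y)"
    proof (rule indep_var_compose[OF XY])
      show "h l \<in> borel_measurable (PiM {..<k} (\<lambda>_. ?N))"
        unfolding PiM by simp
      have "(\<lambda>y. y k) \<in> PiM {k} (\<lambda>_. ?N) \<rightarrow>\<^sub>M ?N"
        by (rule measurable_component_singleton) simp
      then show "(\<lambda>y. indicator {l} (y k) :: real) \<in> borel_measurable (PiM {k} (\<lambda>_. ?N))"
        by (rule measurable_compose) simp
    qed
    then show ?thesis by (simp add: comp_def hX Yk)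
  qed
  have "(\<integral>\<omega>. h (ell k \<omega>) (\<lambda>i. ell i \<omega>) \<partial>M) =
      (\<integral>\<omega>. (\<Sum>l\<in>{1..d}. h l (\<lambda>i. ell i \<omega>) * indicator {l} (ell k \<omega>)) \<partial>M)"
  proof (rule Bochner_Integration.integral_cong[OF refl])
    fix \<omega> assume "\<omega> \<in> space M"
    then show "h (ell k \<omega>) (\<lambda>i. ell i \<omega>) =
        (\<Sum>l\<in>{1..d}. h l (\<lambda>i. ell i \<omega>) * indicator {l} (ell k \<omega>))"
      \<comment> \<open>Only the summand \<open>l = ell k \<omega>\<close> survives.\<close>
      using range[of \<omega> k] by (subst sum.remove[of _ "ell k \<omega>"]) (auto intro!: sum.neutral)
  qed
  also have "\<dots> = (\<Sum>l\<in>{1..d}. \<integral>\<omega>. h l (\<lambda>i. ell i \<omega>) * indicator {l} (ell k \<omega>) \<partial>M)"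
    by (intro Bochner_Integration.integral_sum indep_var_integrable[OF ind int ind_int])
  also have "\<dots> = (\<Sum>l\<in>{1..d}. (\<integral>\<omega>. h l (\<lambda>i. ell i \<omega>) \<partial>M) * (1 / real d))"
    by (intro sum.cong refl)
      (simp add: indep_var_lebesgue_integral[OF ind int ind_int] prob del: of_nat_1)
  also have "\<dots> = (\<integral>\<omega>. (\<Sum>l\<in>{1..d}. h l (\<lambda>i. ell i \<omega>)) \<partial>M) / real d"
    by (simp add: Bochner_Integration.integral_sum[OF int] sum_divide_distrib)
  finally show ?thesis .
qed

text \<open>The full gradient norm is at most the sum of block norms, whose expectation is
  \<open>d\<close> times that of the selected block norm; the pathwise bound then applies to every
  outcome.\<close>

lemma uniform_random_bound:
  fixes f :: "real ^ 'n::finite \<Rightarrow> real" and x0 :: "real ^ 'n" and k :: nat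
  assumes rule: "uniform_random_rule M d ell"
    and run: "\<And>e. (\<And>i. e i \<in> {1..d}) \<Longrightarrow> badag_run f g f_low \<sigma> Lbar d b Lb e"
    and partition: "block_partition d b"
  defines "avg \<equiv> \<lambda>\<omega>. 1 / (real k + 1) *
             (\<Sum>j\<le>k. norm (g (badag_iter g \<sigma> x0 b (\<lambda>i. ell i \<omega>) j)))"
  shows "integrable M avg"
    and "prob_space.expectation M avg
           \<le> real d * (badag_Theta (f x0 - f_low) \<sigma> CARD('n) Lbar / sqrt (real k + 1))"
proof -
  interpret prob_space M using rule by (simp add: uniform_random_rule_def)
  have d: "1 \<le> d" by (rule block_partition_pos[OF partition])
  have range: "ell i \<omega> \<in> {1..d}" if "\<omega> \<in> space M" for i \<omega>
    using rule that measurable_space[of "ell i" M "count_space {1..d}" \<omega>]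
    unfolding uniform_random_rule_def indep_vars_def by simp
  let ?iter = "\<lambda>e j. badag_iter g \<sigma> x0 b e j"
  define h where "h j l e = norm (restr (b l) (g (?iter e j)))" for j l e
  define e where "e \<omega> = (\<lambda>i. ell i \<omega>)" for \<omega>
  have iter_past: "?iter e j = ?iter e' j" if "\<And>i. i < j \<Longrightarrow> e i = e' i" for e e' j
    unfolding badag_iter_def by (rule arg_cong[where f = fst]) (rule badag_state_cong[OF that])
  have int_g: "integrable M (\<lambda>\<omega>. norm (g (?iter (e \<omega>) j)))" for j
    unfolding e_def
    by (rule uniform_random_past_integrable[OF rule, where k = j and h = "\<lambda>u. norm (g (?iter u j))"])
      (rule arg_cong[where f = "\<lambda>y. norm (g y)", OF iter_past])
  have h_past: "h j l u = h j l v" if "\<And>i. i < j \<Longrightarrow> u i = v i" for j l u v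
    unfolding h_def by (simp only: iter_past[OF that])
  have int_block: "integrable M (\<lambda>\<omega>. h j l (e \<omega>))" for j l
    unfolding e_def
    by (rule uniform_random_past_integrable[OF rule, where k = j and h = "h j l"]) (rule h_past)
  have int_sel: "integrable M (\<lambda>\<omega>. h j (ell j \<omega>) (e \<omega>))" for j
  proof -
    \<comment> \<open>The selected block norm also depends on choice \<open>j\<close>, so the
      relevant past has length \<open>Suc j\<close>.\<close>
    have "h j (u j) u = h j (v j) v" if "\<And>i. i < Suc j \<Longrightarrow> u i = v i" for u v
      using h_past[of j u v "v j"] that by simp
    from uniform_random_past_integrable[OF rule, of "Suc j" "\<lambda>u. h j (u j) u", OF this]
    show ?thesis unfolding e_def .
  qed
  show "integrable M avg"
    unfolding avg_def
    using int_g by (intro integrable_mult_right Bochner_Integration.integrable_sum) (simp add: e_def)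
  have g_le: "expectation (\<lambda>\<omega>. norm (g (?iter (e \<omega>) j))) \<le>
      real d * expectation (\<lambda>\<omega>. h j (ell j \<omega>) (e \<omega>))" for j
  proof -
    have "expectation (\<lambda>\<omega>. norm (g (?iter (e \<omega>) j))) \<le>
        expectation (\<lambda>\<omega>. \<Sum>l\<in>{1..d}. h j l (e \<omega>))"
      unfolding h_def
      by (intro integral_mono int_g Bochner_Integration.integrable_sum
          int_block[unfolded h_def] norm_le_sum_norm_blocks partition)
    moreover have "expectation (\<lambda>\<omega>. h j (ell j \<omega>) (e \<omega>)) =
        expectation (\<lambda>\<omega>. \<Sum>l\<in>{1..d}. h j l (e \<omega>)) / real d"
      unfolding e_def
      by (rule uniform_random_conditional_average[OF rule d, where k = j and h = "h j"]) (rule h_past)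
    ultimately show ?thesis using d by simp
  qed
  have "expectation avg = 1 / (real k + 1) * (\<Sum>j\<le>k. expectation (\<lambda>\<omega>. norm (g (?iter (e \<omega>) j))))"
    unfolding avg_def e_def[symmetric] by (simp add: Bochner_Integration.integral_sum[OF int_g])
  also have "\<dots> \<le> 1 / (real k + 1) * (\<Sum>j\<le>k. real d * expectation (\<lambda>\<omega>. h j (ell j \<omega>) (e \<omega>)))"
    by (intro mult_left_mono sum_mono g_le) auto
  also have "\<dots> = real d * expectation (\<lambda>\<omega>. 1 / (real k + 1) * (\<Sum>j\<le>k. h j (ell j \<omega>) (e \<omega>)))"
    by (simp add: Bochner_Integration.integral_sum[OF int_sel] sum_distrib_left[symmetric])
  also have "\<dots> \<le> real d * (badag_Theta (f x0 - f_low) \<sigma> CARD('n) Lbar / sqrt (real k + 1))"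
  proof (intro mult_left_mono integral_le_const)
    show "integrable M (\<lambda>\<omega>. 1 / (real k + 1) * (\<Sum>j\<le>k. h j (ell j \<omega>) (e \<omega>)))"
      by (intro integrable_mult_right Bochner_Integration.integrable_sum int_sel)
    show "AE \<omega> in M. 1 / (real k + 1) * (\<Sum>j\<le>k. h j (ell j \<omega>) (e \<omega>)) \<le>
        badag_Theta (f x0 - f_low) \<sigma> CARD('n) Lbar / sqrt (real k + 1)"
    proof (rule AE_I2)
      fix \<omega> assume "\<omega> \<in> space M"
      then interpret badag_run f g f_low \<sigma> Lbar x0 d b Lb "e \<omega>"
        by (intro run) (simp only: e_def range)
      have "h j (ell j \<omega>) (e \<omega>) = norm (gb j)" for j
        unfolding h_def gb_def x_def by (simp only: e_def)
      then show "1 / (real k + 1) * (\<Sum>j\<le>k. h j (ell j \<omega>) (e \<omega>)) \<le>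
          badag_Theta (f x0 - f_low) \<sigma> CARD('n) Lbar / sqrt (real k + 1)"
        using block_average_bound[of k] by (simp only:)
    qed
  qed simp
  finally show "expectation avg
      \<le> real d * (badag_Theta (f x0 - f_low) \<sigma> CARD('n) Lbar / sqrt (real k + 1))" .
qed

text \<open>Integrability accompanies the bound on the expectation because the integral of a
  non-integrable function is 0 by default.\<close>

theorem theorem4p5:
  fixes f :: "real ^ 'n::finite \<Rightarrow> real"
    and g :: "real ^ 'n \<Rightarrow> real ^ 'n"
    and f_low \<sigma> \<Gamma>0 Lbar \<Theta> :: real
    and x0 :: "real ^ 'n"
    and d :: nat
    and b :: "nat \<Rightarrow> 'n set"
    and Lb :: "nat \<Rightarrow> real"
  assumes gradient: "\<And>x. GDERIV f x :> g x"
    and gradient_continuous: "continuous_on UNIV g"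
    and bounded_below: "\<And>x. f_low \<le> f x"
    and partition: "block_partition d b"
    and Lb_nonneg: "\<And>l. l \<in> {1..d} \<Longrightarrow> 0 \<le> Lb l"
    and block_lipschitz: "block_lipschitz d b Lb g"
    and \<sigma>: "0 < \<sigma>" "\<sigma> < 1"
    and \<Gamma>0: "\<Gamma>0 = f x0 - f_low"
    and Lbar: "Lbar = Max (Lb ` {1..d})"
    and \<Theta>: "\<Theta> = badag_Theta \<Gamma>0 \<sigma> CARD('n) Lbar"
  shows
    "(\<forall>ell. gauss_southwell g \<sigma> x0 d b ell \<longrightarrow>
        (\<forall>k. 1 / (real k + 1) * (\<Sum>j\<le>k. norm (g (badag_iter g \<sigma> x0 b ell j)))
               \<le> sqrt (real d) * (\<Theta> / sqrt (real k + 1))))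
     \<and>
     (\<forall>L\<ge>0. (\<forall>x y. norm (g x - g y) \<le> L * norm (x - y)) \<longrightarrow>
        (\<forall>T. 1 / (real T + 1) *
               (\<Sum>t\<le>T. norm (g (badag_iter g \<sigma> x0 b (cyclic_rule d) (t * d))))
               \<le> sqrt (2 * (1 + real d * (L\<^sup>2 / \<sigma>\<^sup>2))) * (\<Theta> / sqrt (real T + 1))))
     \<and>
     (\<forall>(M :: 'a measure) ell. uniform_random_rule M d ell \<longrightarrow>
        (\<forall>k. let avg = (\<lambda>\<omega>. 1 / (real k + 1) *
                   (\<Sum>j\<le>k. norm (g (badag_iter g \<sigma> x0 b (\<lambda>i. ell i \<omega>) j))))
             in integrable M avg \<and>
                prob_space.expectation M avg \<le> real d * (\<Theta> / sqrt (real k + 1))))"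
proof -
  \<comment> \<open>The predicate has no argument \<open>x0\<close>, since its assumptions do not
    involve the starting point.\<close>
  have run: "badag_run f g f_low \<sigma> Lbar d b Lb e" if "\<And>i. e i \<in> {1..d}" for e
    by unfold_locales (use assms that in \<open>simp_all del: atLeastAtMost_iff\<close>)
  have \<Theta>_eq: "\<Theta> = badag_Theta (f x0 - f_low) \<sigma> CARD('n) Lbar"
    by (simp add: \<Theta> \<Gamma>0)
  show ?thesis
  proof (intro conjI allI impI)
    fix ell k
    assume GS: "gauss_southwell g \<sigma> x0 d b ell"
    then interpret badag_run f g f_low \<sigma> Lbar x0 d b Lb ell
      by (intro run) (simp add: gauss_southwell_def)
    show "1 / (real k + 1) * (\<Sum>j\<le>k. norm (g (badag_iter g \<sigma> x0 b ell j)))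
        \<le> sqrt (real d) * (\<Theta> / sqrt (real k + 1))"
      using gauss_southwell_bound[OF GS, of k] by (simp only: x_def \<Theta>_eq)
  next
    fix L :: real and T
    assume L: "0 \<le> L" "\<forall>x y. norm (g x - g y) \<le> L * norm (x - y)"
    interpret badag_run f g f_low \<sigma> Lbar x0 d b Lb "cyclic_rule d"
      by (intro run) (use block_partition_pos[OF partition] in \<open>simp add: cyclic_rule_def Suc_le_eq\<close>)
    show "1 / (real T + 1) *
          (\<Sum>t\<le>T. norm (g (badag_iter g \<sigma> x0 b (cyclic_rule d) (t * d))))
        \<le> sqrt (2 * (1 + real d * (L\<^sup>2 / \<sigma>\<^sup>2))) * (\<Theta> / sqrt (real T + 1))"
      using cyclic_bound[OF refl L(1) L(2)[rule_format], of T] by (simp only: x_def \<Theta>_eq)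
  next
    fix M :: "'a measure" and ell k
    assume UR: "uniform_random_rule M d ell"
    show "let avg = (\<lambda>\<omega>. 1 / (real k + 1) *
                (\<Sum>j\<le>k. norm (g (badag_iter g \<sigma> x0 b (\<lambda>i. ell i \<omega>) j))))
          in integrable M avg \<and>
             prob_space.expectation M avg \<le> real d * (\<Theta> / sqrt (real k + 1))"
      using uniform_random_bound[OF UR run partition] unfolding Let_def \<Theta>_eq by blast
  qed
qed

end
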